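(* Let $X_2=\mathcal{O}_{\mathbb{P}^1}(-2)$ be obtained by gluing two copies of $\mathbb{C}^2$ with coordinates $(\alpha,\beta)$ and $(\tilde\alpha,\tilde\beta)$ by $\tilde\alpha=\alpha^2\beta$, $\tilde\beta=\alpha^{-1}$; the zero section is $\{\beta=0\}=\{\tilde\alpha=0\}$, and the function $|\beta|(1+|\alpha|^2)=|\tilde\alpha|(1+|\tilde\beta|^2)$ is globally defined on $X_2$. For $T\in\mathbb{R}$ put $R_T=\sqrt{|\beta|^2(1+|\alpha|^2)^2+T}$ (with $\sqrt{-s}=\sqrt{-1}\sqrt{s}$ for $s>0$) and, in the coordinates $(\alpha,\beta)$, let $$\begin{aligned} \omega_{\sqrt T}=\sqrt{-1}\Bigl\{&\frac1{(1+|\alpha|^2)^2}\Bigl(R_T+\frac{|\beta|^2(1+|\alpha|^2)^2|\alpha|^2}{R_T}\Bigr)d\alpha\wedge d\bar\alpha+\frac{1+|\alpha|^2}{2R_T}\,\bar\alpha\beta\,d\alpha\wedge d\bar\beta\\ &+\frac{1+|\alpha|^2}{2R_T}\,\alpha\bar\beta\,d\beta\wedge d\bar\alpha+\frac{(1+|\alpha|^2)^2}{4R_T}\,d\beta\wedge d\bar\beta\Bigr\}.\end{aligned}$$ Then: (1) for $T>0$, $\omega_{\sqrt T}$ defines a Kähler metric on the whole space $X_2$; (2) for $T=0$, the metric blows up along the zero section of $X_2$; (3) for $T=-b^2<0$ ($b>0$), $\omega_{\sqrt T}$ defines a Kähler metric outside the circle bundle $\{|\beta|(1+|\alpha|^2)=b\}$,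 i.e. on $\{|\beta|(1+|\alpha|^2)>b\}$, and a purely imaginary pseudo-Kähler metric inside it, i.e. on $\{|\beta|(1+|\alpha|^2)<b\}$.
   Context: "Defines a Kähler metric" on an open set means that the form is a smooth real closed positive $(1,1)$-form there. "Defines a purely imaginary pseudo-Kähler metric" means that the form is $\sqrt{-1}$ times a smooth real closed nondegenerate $(1,1)$-form. "Blows up along the zero section" means that the form is not bounded near the zero section: the coefficient of $\sqrt{-1}\,d\beta\wedge d\bar\beta$ tends to $+\infty$ as $\beta\to0$ with $\alpha$ fixed. The forms are extended to the second chart by the change of coordinates. *)

theory Defs
  imports "HOL-Analysis.Analysis"
begin

section \<open>Differential forms on open subsets of complex 2-space\<close>

type_synonym C2 = "complex \<times> complex"

text \<open>A complex-valued 2-form: point, then two real tangent vectors (identified with elements of C2).\<close>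
type_synonym form2 = "C2 \<Rightarrow> C2 \<Rightarrow> C2 \<Rightarrow> complex"

text \<open>The library has no notion of smooth map. On open sets of a finite-dimensional space the
  following says that all iterated directional derivatives up to order k exist and are continuous.\<close>
primrec Ck_on ::
  "nat \<Rightarrow> 'a::real_normed_vector set \<Rightarrow> ('a \<Rightarrow> 'b::real_normed_vector) \<Rightarrow> bool"
where
  "Ck_on 0 S f \<longleftrightarrow> continuous_on S f"
| "Ck_on (Suc k) S f \<longleftrightarrow>
     (\<forall>x\<in>S. f differentiable (at x)) \<and> (\<forall>v. Ck_on k S (\<lambda>x. frechet_derivative f (at x) v))"

definition smooth_on :: "'a::real_normed_vector set \<Rightarrow> ('a \<Rightarrow> 'b::real_normed_vector) \<Rightarrow> bool"
  where "smooth_on S f \<longleftrightarrow> (\<forall>k. Ck_on k S f)"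

definition wedge :: "(C2 \<Rightarrow> complex) \<Rightarrow> (C2 \<Rightarrow> complex) \<Rightarrow> C2 \<Rightarrow> C2 \<Rightarrow> complex"
  where "wedge \<theta> \<eta> u v = \<theta> u * \<eta> v - \<theta> v * \<eta> u"

definition dz1 :: "C2 \<Rightarrow> complex" where "dz1 u = fst u"
definition dz2 :: "C2 \<Rightarrow> complex" where "dz2 u = snd u"
definition dz1_bar :: "C2 \<Rightarrow> complex" where "dz1_bar u = cnj (fst u)"
definition dz2_bar :: "C2 \<Rightarrow> complex" where "dz2_bar u = cnj (snd u)"

definition form11 :: "complex \<Rightarrow> complex \<Rightarrow> complex \<Rightarrow> complex \<Rightarrow> C2 \<Rightarrow> C2 \<Rightarrow> complex"
  where "form11 g11 g12 g21 g22 u v =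
    \<i> * (g11 * wedge dz1 dz1_bar u v + g12 * wedge dz1 dz2_bar u v
       + g21 * wedge dz2 dz1_bar u v + g22 * wedge dz2 dz2_bar u v)"

definition has_coeffs_on ::
  "C2 set \<Rightarrow> form2 \<Rightarrow> (C2 \<Rightarrow> complex) \<Rightarrow> (C2 \<Rightarrow> complex) \<Rightarrow> (C2 \<Rightarrow> complex) \<Rightarrow> (C2 \<Rightarrow> complex) \<Rightarrow> bool"
  where "has_coeffs_on S \<omega> g11 g12 g21 g22 \<longleftrightarrow>
    (\<forall>p\<in>S. \<omega> p = form11 (g11 p) (g12 p) (g21 p) (g22 p))"

definition type11_on :: "C2 set \<Rightarrow> form2 \<Rightarrow> bool"
  where "type11_on S \<omega> \<longleftrightarrow> (\<exists>g11 g12 g21 g22. has_coeffs_on S \<omega> g11 g12 g21 g22)"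

definition smooth_form_on :: "C2 set \<Rightarrow> form2 \<Rightarrow> bool"
  where "smooth_form_on S \<omega> \<longleftrightarrow> (\<forall>u v. smooth_on S (\<lambda>p. \<omega> p u v))"

definition real_form_on :: "C2 set \<Rightarrow> form2 \<Rightarrow> bool"
  where "real_form_on S \<omega> \<longleftrightarrow> (\<forall>p\<in>S. \<forall>u v. \<omega> p u v \<in> \<real>)"

definition ext_deriv :: "form2 \<Rightarrow> C2 \<Rightarrow> C2 \<Rightarrow> C2 \<Rightarrow> C2 \<Rightarrow> complex"
  where "ext_deriv \<omega> p u v w =
      frechet_derivative (\<lambda>q. \<omega> q v w) (at p) u
    - frechet_derivative (\<lambda>q. \<omega> q u w) (at p) v
    + frechet_derivative (\<lambda>q. \<omega> q u v) (at p) w"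

definition closed_form_on :: "C2 set \<Rightarrow> form2 \<Rightarrow> bool"
  where "closed_form_on S \<omega> \<longleftrightarrow> (\<forall>p\<in>S. \<forall>u v w. ext_deriv \<omega> p u v w = 0)"

definition Jmult :: "C2 \<Rightarrow> C2" where "Jmult u = (\<i> * fst u, \<i> * snd u)"

text \<open>Only used together with reality, so the real part is the value itself.\<close>
definition positive_form_on :: "C2 set \<Rightarrow> form2 \<Rightarrow> bool"
  where "positive_form_on S \<omega> \<longleftrightarrow> (\<forall>p\<in>S. \<forall>u. u \<noteq> 0 \<longrightarrow> Re (\<omega> p u (Jmult u)) > 0)"

definition nondegenerate_form_on :: "C2 set \<Rightarrow> form2 \<Rightarrow> bool"
  where "nondegenerate_form_on S \<omega> \<longleftrightarrow> (\<forall>p\<in>S. \<forall>u. u \<noteq> 0 \<longrightarrow> (\<exists>v. \<omega> p u v \<noteq> 0))"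

definition pullback :: "(C2 \<Rightarrow> C2) \<Rightarrow> form2 \<Rightarrow> form2"
  where "pullback \<phi> \<omega> p u v =
    \<omega> (\<phi> p) (frechet_derivative \<phi> (at p) u) (frechet_derivative \<phi> (at p) v)"


section \<open>The space X2\<close>

definition transition :: "C2 \<Rightarrow> C2"
  where "transition p = ((fst p)\<^sup>2 * snd p, inverse (fst p))"

definition glue :: "C2 + C2 \<Rightarrow> C2 + C2 \<Rightarrow> bool"
  where "glue x y \<longleftrightarrow> x = y \<or>
    (\<exists>p. fst p \<noteq> 0 \<and> (x = Inl p \<and> y = Inr (transition p) \<or> x = Inr (transition p) \<and> y = Inl p))"

lemma transition_inj:
  assumes "fst p \<noteq> 0" "fst q \<noteq> 0" "transition p = transition q"
  shows "p = q"
  using assms by (auto simp: transition_def prod_eq_iff)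

lemma equivp_glue: "equivp glue"
proof (rule equivpI)
  show "reflp glue" by (auto simp: reflp_def glue_def)
  show "symp glue" by (auto simp: symp_def glue_def)
  show "transp glue"
    unfolding transp_def glue_def using transition_inj by blast
qed

quotient_type X2 = "C2 + C2" / glue
  by (rule equivp_glue)

lift_definition chart1 :: "C2 \<Rightarrow> X2" is Inl .
lift_definition chart2 :: "C2 \<Rightarrow> X2" is Inr .

text \<open>The quotient topology.\<close>
instantiation X2 :: topological_space
begin

definition open_X2 :: "X2 set \<Rightarrow> bool"
  where "open_X2 U \<longleftrightarrow> open (chart1 -` U) \<and> open (chart2 -` U)"

instance
  by standard (auto simp: open_X2_def vimage_Union)

end

text \<open>In the second chart the fibre coordinate is the first one.\<close>
lift_definition fibre_norm :: "X2 \<Rightarrow> real"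
  is "case_sum (\<lambda>p. cmod (snd p) * (1 + (cmod (fst p))\<^sup>2))
               (\<lambda>p. cmod (fst p) * (1 + (cmod (snd p))\<^sup>2))"
  by (auto simp: glue_def transition_def norm_mult norm_power norm_inverse norm_divide field_simps
      power2_eq_square)

lift_definition on_zero_section :: "X2 \<Rightarrow> bool"
  is "case_sum (\<lambda>p. snd p = 0) (\<lambda>p. fst p = 0)"
  by (auto simp: glue_def transition_def)

definition zero_section :: "X2 set"
  where "zero_section = {x. on_zero_section x}"


section \<open>Differential forms on open subsets of X2\<close>

text \<open>A form on an open set U of X2 is given by its expressions in the two charts, which agree
  under the change of coordinates; values outside the preimages of U are irrelevant.\<close>
type_synonym X2_form = "form2 \<times> form2"

definition compatible_on :: "X2 set \<Rightarrow> X2_form \<Rightarrow> bool"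
  where "compatible_on U \<Omega> \<longleftrightarrow>
    (\<forall>p. fst p \<noteq> 0 \<and> chart1 p \<in> U \<longrightarrow> fst \<Omega> p = pullback transition (snd \<Omega>) p)"

definition smooth_real_closed_11_on :: "X2 set \<Rightarrow> X2_form \<Rightarrow> bool"
  where "smooth_real_closed_11_on U \<Omega> \<longleftrightarrow> open U \<and> compatible_on U \<Omega> \<and>
    (\<forall>(S, \<omega>) \<in> {(chart1 -` U, fst \<Omega>), (chart2 -` U, snd \<Omega>)}.
       smooth_form_on S \<omega> \<and> real_form_on S \<omega> \<and> closed_form_on S \<omega> \<and> type11_on S \<omega>)"

definition kaehler_on :: "X2 set \<Rightarrow> X2_form \<Rightarrow> bool"
  where "kaehler_on U \<Omega> \<longleftrightarrow> smooth_real_closed_11_on U \<Omega> \<and>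
    positive_form_on (chart1 -` U) (fst \<Omega>) \<and> positive_form_on (chart2 -` U) (snd \<Omega>)"

definition pseudo_kaehler_on :: "X2 set \<Rightarrow> X2_form \<Rightarrow> bool"
  where "pseudo_kaehler_on U \<Omega> \<longleftrightarrow> smooth_real_closed_11_on U \<Omega> \<and>
    nondegenerate_form_on (chart1 -` U) (fst \<Omega>) \<and> nondegenerate_form_on (chart2 -` U) (snd \<Omega>)"

definition imaginary_pseudo_kaehler_on :: "X2 set \<Rightarrow> X2_form \<Rightarrow> bool"
  where "imaginary_pseudo_kaehler_on U \<Omega> \<longleftrightarrow> (\<exists>H. pseudo_kaehler_on U H \<and>
    (\<forall>p \<in> chart1 -` U. \<forall>u v. fst \<Omega> p u v = \<i> * fst H p u v) \<and>
    (\<forall>p \<in> chart2 -` U. \<forall>u v. snd \<Omega> p u v = \<i> * snd H p u v))"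

text \<open>The coefficient in question is that of the fibre direction, in either chart; the second
  chart is needed to reach the point of the zero section missing from the first.\<close>
definition blows_up_along_zero_section :: "X2_form \<Rightarrow> bool"
  where "blows_up_along_zero_section \<Omega> \<longleftrightarrow>
    (\<exists>g11 g12 g21 (g22 :: C2 \<Rightarrow> real).
       has_coeffs_on (chart1 -` (- zero_section)) (fst \<Omega>) g11 g12 g21 (\<lambda>p. complex_of_real (g22 p)) \<and>
       (\<forall>\<alpha>. filterlim (\<lambda>\<beta>. g22 (\<alpha>, \<beta>)) at_top (at 0))) \<and>
    (\<exists>(h11 :: C2 \<Rightarrow> real) h12 h21 h22.
       has_coeffs_on (chart2 -` (- zero_section)) (snd \<Omega>) (\<lambda>p. complex_of_real (h11 p)) h12 h21 h22 \<and>
       (\<forall>\<beta>'. filterlim (\<lambda>\<alpha>'. h11 (\<alpha>', \<beta>')) at_top (at 0)))"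

text \<open>The expression in the second chart of a continuous form on U is determined by the first
  chart, whose image is dense.\<close>
definition extends_on :: "X2 set \<Rightarrow> form2 \<Rightarrow> X2_form \<Rightarrow> bool"
  where "extends_on U \<omega> \<Omega> \<longleftrightarrow> (\<forall>p \<in> chart1 -` U. fst \<Omega> p = \<omega> p)"

definition defines_kaehler_metric_on :: "X2 set \<Rightarrow> form2 \<Rightarrow> bool"
  where "defines_kaehler_metric_on U \<omega> \<longleftrightarrow> (\<exists>\<Omega>. extends_on U \<omega> \<Omega> \<and> kaehler_on U \<Omega>)"

definition defines_imaginary_pseudo_kaehler_metric_on :: "X2 set \<Rightarrow> form2 \<Rightarrow> bool"
  where "defines_imaginary_pseudo_kaehler_metric_on U \<omega> \<longleftrightarrow>
    (\<exists>\<Omega>. extends_on U \<omega> \<Omega> \<and> imaginary_pseudo_kaehler_on U \<Omega>)"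

definition defines_kaehler_metric_blowing_up_along_zero_section :: "form2 \<Rightarrow> bool"
  where "defines_kaehler_metric_blowing_up_along_zero_section \<omega> \<longleftrightarrow>
    (\<exists>\<Omega>. extends_on (- zero_section) \<omega> \<Omega> \<and> kaehler_on (- zero_section) \<Omega> \<and>
         blows_up_along_zero_section \<Omega>)"


section \<open>The family of forms\<close>

text \<open>The principal square root takes the value i times sqrt s at -s for s > 0.\<close>
definition R :: "real \<Rightarrow> complex \<Rightarrow> complex \<Rightarrow> complex"
  where "R T \<alpha> \<beta> = csqrt (complex_of_real ((cmod \<beta>)\<^sup>2 * (1 + (cmod \<alpha>)\<^sup>2)\<^sup>2 + T))"

definition omega :: "real \<Rightarrow> form2"
  where "omega T p =
    (let \<alpha> = fst p; \<beta> = snd p; r = R T \<alpha> \<beta>;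
         a = complex_of_real ((cmod \<alpha>)\<^sup>2); b = complex_of_real ((cmod \<beta>)\<^sup>2)
     in form11
          (1 / (1 + a)\<^sup>2 * (r + b * (1 + a)\<^sup>2 * a / r))
          ((1 + a) / (2 * r) * (cnj \<alpha> * \<beta>))
          ((1 + a) / (2 * r) * (\<alpha> * cnj \<beta>))
          ((1 + a)\<^sup>2 / (4 * r)))"

end

theory Submission
  imports Defs
begin

text \<open>
  Put \<open>n = 1 + |\<alpha>|\<^sup>2\<close>, \<open>s = |\<beta>|\<^sup>2 n\<^sup>2\<close> and \<open>\<eta> = n d\<beta> + 2 \<beta> cnj \<alpha> d\<alpha>\<close>. Completing the square in the given
  coefficients yields, with \<open>R\<^sup>2 = s + T\<close>,
  \<open>\<omega> = \<i> (R n\<^sup>-\<^sup>2 d\<alpha> \<and> d cnj \<alpha> + (4 R)\<^sup>-\<^sup>1 \<eta> \<and> cnj \<eta>)\<close>,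
  the Eguchi-Hanson form, which off the zero section is \<open>\<i> \<partial> cnj \<partial>\<close> of a function of s. In the coframe
  \<open>d\<alpha>, \<eta>\<close> it is diagonal, with coefficients that are nonzero as long as R is: it is real and positive
  where \<open>R > 0\<close>. Where \<open>R = \<i> \<rho>\<close> with \<open>\<rho> > 0\<close>, both coefficients are imaginary, with opposite
  signs, so that \<open>\<omega>\<close> is \<open>\<i>\<close> times a real form of signature \<open>(+,-)\<close>. To treat the two cases
  together, \<open>eguchi_hanson \<epsilon> T\<close> denotes the real form
  \<open>\<i> (\<rho> n\<^sup>-\<^sup>2 d\<alpha> \<and> d cnj \<alpha> + \<epsilon> (4 \<rho>)\<^sup>-\<^sup>1 \<eta> \<and> cnj \<eta>)\<close> with \<open>\<rho>\<^sup>2 = \<epsilon> (s + T)\<close> and \<open>\<epsilon> = 1\<close> or \<open>\<epsilon> = -1\<close>;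
  \<open>\<omega>\<close> equals it for \<open>\<epsilon> = 1\<close> and equals \<open>\<i>\<close> times it for \<open>\<epsilon> = -1\<close>
  (lemmas \<open>omega_eq_eguchi_hanson\<close> and \<open>omega_eq_imaginary_eguchi_hanson\<close>).

  Positivity and nondegeneracy come from a test vector adapted to the coframe (\<open>eguchi_hanson_test_vector\<close>), and
  closedness from three identities in the exterior algebra, one for each power of \<open>\<rho>\<close> that occurs
  (\<open>closed_eguchi_hanson\<close>). The passage to the whole surface rests on a symmetry
  (\<open>eguchi_hanson_transition\<close>): written with the fibre coordinate second, the form has the same expression
  in both charts. Hence the form in the second chart is the pullback along the exchange of coordinates, and all
  properties carry over from the first chart. What remains is to see on which sets \<open>\<epsilon> (s + T)\<close> is positive, and to
  read off the growth of the coefficient \<open>n\<^sup>2 / (4 R) = n / (4 |\<beta>|)\<close> for \<open>T = 0\<close>.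
\<close>

section \<open>Closure properties of maps of class \<open>C\<^sup>k\<close>\<close>

lemma Ck_on_cong:
  assumes "open S" "Ck_on k S f" "\<And>x. x \<in> S \<Longrightarrow> f x = g x"
  shows "Ck_on k S g"
  using assms(2,3)
proof (induction k arbitrary: f g)
  case 0
  then show ?case using continuous_on_cong[of S S f g] by auto
next
  case (Suc k)
  have g': "(g has_derivative frechet_derivative f (at x)) (at x)" if "x \<in> S" for x
    using has_derivative_transform_within_open[OF _ \<open>open S\<close> that Suc.prems(2)] Suc.prems(1) that
    by (simp add: frechet_derivative_works)
  moreover have "Ck_on k S (\<lambda>x. frechet_derivative g (at x) v)" for v
    by (rule Suc.IH[of "\<lambda>x. frechet_derivative f (at x) v"])
      (use Suc.prems(1) in \<open>simp_all add: frechet_derivative_at[OF g', symmetric]\<close>)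
  ultimately show ?case
    by (auto intro: differentiableI)
qed

text \<open>The definition of \<^const>\<open>Ck_on\<close> speaks of the chosen derivative \<^const>\<open>frechet_derivative\<close>.
  On an open set derivatives are unique, so a derivative given by a formula can be used instead; the
  closure properties below are all inductions on k through this rule.\<close>

lemma Ck_on_Suc_derivative:
  assumes "open S" and f': "\<And>x. x \<in> S \<Longrightarrow> (f has_derivative f' x) (at x)"
    and "\<And>v. Ck_on k S (\<lambda>x. f' x v)"
  shows "Ck_on (Suc k) S f"
proof -
  have "Ck_on k S (\<lambda>x. frechet_derivative f (at x) v)" for v
    by (rule Ck_on_cong[OF assms(1) assms(3)[of v]]) (simp add: frechet_derivative_at[OF f', symmetric])
  then show ?thesis
    by (simp add: differentiableI[OF f'])
qed

lemma Ck_on_Suc_has_derivative: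
  "Ck_on (Suc k) S f \<Longrightarrow> x \<in> S \<Longrightarrow> (f has_derivative frechet_derivative f (at x)) (at x)"
  by (simp add: frechet_derivative_works)

lemma Ck_on_SucD: "Ck_on (Suc k) S f \<Longrightarrow> Ck_on k S f"
proof (induction k arbitrary: f)
  case 0
  then show ?case
    by (auto intro!: continuous_at_imp_continuous_on differentiable_imp_continuous_within)
qed auto

lemma Ck_on_const: "Ck_on k S (\<lambda>x. c)"
  by (induction k arbitrary: c) (auto simp: frechet_derivative_const)

lemma Ck_on_bounded_linear_comp:
  assumes "open S" "bounded_linear L" "Ck_on k S f"
  shows "Ck_on k S (\<lambda>x. L (f x))"
  using assms(3)
proof (induction k arbitrary: f)
  case 0
  then show ?case by (auto intro: bounded_linear.continuous_on[OF assms(2)])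
next
  case (Suc k)
  show ?case
    by (rule Ck_on_Suc_derivative[OF \<open>open S\<close> bounded_linear.has_derivative[OF assms(2)
          Ck_on_Suc_has_derivative[OF Suc.prems]]])
      (use Suc in auto)
qed

lemma Ck_on_comp_bounded_linear:
  assumes "open S" "bounded_linear L" "Ck_on k S f"
  shows "Ck_on k (L -` S) (\<lambda>x. f (L x))"
  using assms(3)
proof (induction k arbitrary: f)
  case 0
  then show ?case
    using continuous_on_compose2[OF _ linear_continuous_on[OF assms(2)], of S f "L -` S"] by auto
next
  case (Suc k)
  have "open (L -` S)"
    using assms(1,2) by (intro open_vimage linear_continuous_on)
  moreover have "((\<lambda>x. f (L x)) has_derivative (\<lambda>v. frechet_derivative f (at (L x)) (L v))) (at x)"
    if "x \<in> L -` S" for x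
    using that by (intro has_derivative_compose[OF bounded_linear.has_derivative[OF assms(2) has_derivative_ident]]
        Ck_on_Suc_has_derivative[OF Suc.prems]) auto
  ultimately show ?case
    by (rule Ck_on_Suc_derivative) (use Suc in auto)
qed

lemma Ck_on_bounded_linear:
  assumes "bounded_linear L"
  shows "Ck_on k S L"
proof (cases k)
  case 0
  then show ?thesis by (simp add: linear_continuous_on assms)
next
  case (Suc m)
  have "L differentiable at x" and "frechet_derivative L (at x) = L" for x
    using bounded_linear_imp_has_derivative[OF assms]
    by (auto simp: differentiable_def frechet_derivative_at[symmetric])
  then show ?thesis by (simp add: Suc Ck_on_const)
qed

lemma Ck_on_add:
  assumes "open S" "Ck_on k S f" "Ck_on k S g"
  shows "Ck_on k S (\<lambda>x. f x + g x)"
  using assms(2,3)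
proof (induction k arbitrary: f g)
  case 0
  then show ?case by (auto intro: continuous_intros)
next
  case (Suc k)
  show ?case
    by (rule Ck_on_Suc_derivative[OF \<open>open S\<close> has_derivative_add[OF
          Ck_on_Suc_has_derivative[OF Suc.prems(1)] Ck_on_Suc_has_derivative[OF Suc.prems(2)]]])
      (use Suc in auto)
qed

lemma Ck_on_mult:
  fixes f g :: "'a::real_normed_vector \<Rightarrow> 'b::real_normed_algebra"
  assumes "open S" "Ck_on k S f" "Ck_on k S g"
  shows "Ck_on k S (\<lambda>x. f x * g x)"
  using assms(2,3)
proof (induction k arbitrary: f g)
  case 0
  then show ?case by (auto intro: continuous_intros)
next
  case (Suc k)
  show ?case
  proof (rule Ck_on_Suc_derivative[OF \<open>open S\<close>])
    show "((\<lambda>x. f x * g x) has_derivative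
        (\<lambda>v. f x * frechet_derivative g (at x) v + frechet_derivative f (at x) v * g x)) (at x)"
      if "x \<in> S" for x
      using Suc.prems that by (intro has_derivative_mult Ck_on_Suc_has_derivative)
    show "Ck_on k S (\<lambda>x. f x * frechet_derivative g (at x) v + frechet_derivative f (at x) v * g x)" for v
      by (rule Ck_on_add[OF assms(1)]; rule Suc.IH)
        (use Suc.prems Suc.prems[THEN Ck_on_SucD] in simp_all)
  qed
qed

text \<open>The derivative of the inverse is a polynomial in the inverse and the derivative of f. Hence class
  \<open>C\<^sup>k\<close> for the inverse, known by induction, improves itself to class \<open>C\<^sup>k\<^sup>+\<^sup>1\<close>; the square root behaves
  in the same way.\<close>

lemma Ck_on_inverse:
  fixes f :: "'a::real_normed_vector \<Rightarrow> 'b::real_normed_div_algebra"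
  assumes "open S" "Ck_on k S f" and nz: "\<And>x. x \<in> S \<Longrightarrow> f x \<noteq> 0"
  shows "Ck_on k S (\<lambda>x. inverse (f x))"
  using assms(2)
proof (induction k)
  case 0
  then show ?case using nz by (auto intro!: continuous_intros)
next
  case (Suc k)
  let ?f' = "\<lambda>x v. - (inverse (f x) * frechet_derivative f (at x) v * inverse (f x))"
  have inv: "Ck_on k S (\<lambda>x. inverse (f x))"
    using Suc Ck_on_SucD by blast
  show ?case
  proof (rule Ck_on_Suc_derivative[OF \<open>open S\<close>])
    show "((\<lambda>x. inverse (f x)) has_derivative ?f' x) (at x)" if "x \<in> S" for x
      using Deriv.has_derivative_inverse[OF nz[OF that] Ck_on_Suc_has_derivative[OF Suc.prems that]] .
    show "Ck_on k S (\<lambda>x. ?f' x v)" for v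
      using Suc.prems inv
      by (intro Ck_on_bounded_linear_comp[OF assms(1) bounded_linear_minus[OF bounded_linear_ident]]
          Ck_on_mult assms(1)) auto
  qed
qed

lemma Ck_on_sqrt:
  assumes "open S" "Ck_on k S f" and pos: "\<And>x. x \<in> S \<Longrightarrow> f x > 0"
  shows "Ck_on k S (\<lambda>x. sqrt (f x))"
  using assms(2)
proof (induction k)
  case 0
  then show ?case by (simp add: continuous_on_real_sqrt)
next
  case (Suc k)
  let ?f' = "\<lambda>x v. inverse (sqrt (f x)) * (1/2) * frechet_derivative f (at x) v"
  have "Ck_on k S (\<lambda>x. sqrt (f x))"
    using Suc Ck_on_SucD by blast
  then have inv: "Ck_on k S (\<lambda>x. inverse (sqrt (f x)))"
    using assms(1) pos by (intro Ck_on_inverse) (simp_all add: order_less_imp_not_eq2)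
  show ?case
  proof (rule Ck_on_Suc_derivative[OF \<open>open S\<close>])
    show "((\<lambda>x. sqrt (f x)) has_derivative ?f' x) (at x)" if "x \<in> S" for x
      using has_derivative_compose[OF Ck_on_Suc_has_derivative[OF Suc.prems that]
          DERIV_real_sqrt[OF pos[OF that], unfolded has_field_derivative_def]] by simp
    show "Ck_on k S (\<lambda>x. ?f' x v)" for v
      using Suc.prems inv by (intro Ck_on_mult Ck_on_const assms(1)) auto
  qed
qed

lemma Ck_on_fst: "open S \<Longrightarrow> Ck_on k S (fst :: C2 \<Rightarrow> complex)"
  and Ck_on_snd: "open S \<Longrightarrow> Ck_on k S (snd :: C2 \<Rightarrow> complex)"
  by (simp_all add: Ck_on_bounded_linear bounded_linear_fst bounded_linear_snd)

lemma Ck_on_cnj: "open S \<Longrightarrow> Ck_on k S f \<Longrightarrow> Ck_on k S (\<lambda>x. cnj (f x))"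
  by (rule Ck_on_bounded_linear_comp[OF _ bounded_linear_cnj])

lemma Ck_on_of_real:
  fixes f :: "'a::real_normed_vector \<Rightarrow> real"
  shows "open S \<Longrightarrow> Ck_on k S f \<Longrightarrow> Ck_on k S (\<lambda>x. complex_of_real (f x))"
  by (rule Ck_on_bounded_linear_comp[OF _ bounded_linear_of_real])

lemma Ck_on_diff:
  assumes "open S" "Ck_on k S f" "Ck_on k S g"
  shows "Ck_on k S (\<lambda>x. f x - g x)"
  using Ck_on_add[OF assms(1,2) Ck_on_bounded_linear_comp[OF assms(1)
      bounded_linear_minus[OF bounded_linear_ident] assms(3)]] by simp

lemma cmod_sq: "(cmod z)\<^sup>2 = Re z * Re z + Im z * Im z"
  by (simp add: cmod_power2 flip: power2_eq_square)

lemma Ck_on_cmod_sq: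
  assumes "open S" "Ck_on k S f"
  shows "Ck_on k S (\<lambda>x. (cmod (f x))\<^sup>2)"
  unfolding cmod_sq
  by (intro Ck_on_add Ck_on_mult assms
      Ck_on_bounded_linear_comp[OF _ bounded_linear_Re] Ck_on_bounded_linear_comp[OF _ bounded_linear_Im])

section \<open>The form with its square completed\<close>

definition one_plus_sq :: "C2 \<Rightarrow> real"
  where "one_plus_sq p = 1 + (cmod (fst p))\<^sup>2"

definition fibre_sq :: "C2 \<Rightarrow> real"
  where "fibre_sq p = (cmod (snd p) * one_plus_sq p)\<^sup>2"

text \<open>The \<open>(1,0)\<close>-form \<open>(1 + |\<alpha>|\<^sup>2) d\<beta> + 2 \<beta> cnj \<alpha> d\<alpha>\<close>. With s = \<^const>\<open>fibre_sq\<close> it is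
  \<open>\<beta> (1 + |\<alpha>|\<^sup>2) \<partial>(log s)\<close>, the factor removing the pole of \<open>d\<beta> / \<beta>\<close> on the zero section.\<close>

definition eta :: "C2 \<Rightarrow> C2 \<Rightarrow> complex"
  where "eta p u = complex_of_real (one_plus_sq p) * snd u + 2 * (cnj (fst p) * snd p) * fst u"

text \<open>With \<open>\<epsilon> = 1\<close> this is the value of R where R is real, with \<open>\<epsilon> = -1\<close> it is \<open>R / \<i>\<close> where R is imaginary.\<close>

definition radial :: "real \<Rightarrow> real \<Rightarrow> C2 \<Rightarrow> real"
  where "radial \<epsilon> T p = sqrt (\<epsilon> * (fibre_sq p + T))"

definition eguchi_hanson :: "real \<Rightarrow> real \<Rightarrow> form2"
  where "eguchi_hanson \<epsilon> T p u v =
    \<i> * (complex_of_real (radial \<epsilon> T p / (one_plus_sq p)\<^sup>2) * wedge dz1 dz1_bar u v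
       + complex_of_real (\<epsilon> / (4 * radial \<epsilon> T p)) * wedge (eta p) (\<lambda>w. cnj (eta p w)) u v)"

lemma one_plus_sq_pos [simp]: "one_plus_sq p > 0"
  by (simp add: one_plus_sq_def add_pos_nonneg)

lemma one_plus_sq_neq_0 [simp]: "one_plus_sq p \<noteq> 0"
  using one_plus_sq_pos[of p] by linarith

lemma of_real_one_plus_sq: "complex_of_real (one_plus_sq p) = 1 + fst p * cnj (fst p)"
  by (simp add: one_plus_sq_def complex_norm_square[symmetric] del: of_real_power)

lemma radial_pos: "\<epsilon> * (fibre_sq p + T) > 0 \<Longrightarrow> radial \<epsilon> T p > 0"
  by (simp add: radial_def)

section \<open>Smoothness\<close>

lemma Ck_on_one_plus_sq: "open S \<Longrightarrow> Ck_on k S one_plus_sq"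
  unfolding one_plus_sq_def by (intro Ck_on_add Ck_on_const Ck_on_cmod_sq Ck_on_fst)

lemma Ck_on_radial:
  assumes "open S" "\<And>p. p \<in> S \<Longrightarrow> \<epsilon> * (fibre_sq p + T) > 0"
  shows "Ck_on k S (radial \<epsilon> T)"
proof -
  have "Ck_on k S (\<lambda>p. \<epsilon> * ((cmod (snd p))\<^sup>2 * (one_plus_sq p * one_plus_sq p) + T))"
    using assms(1) by (intro Ck_on_add Ck_on_mult Ck_on_const Ck_on_cmod_sq Ck_on_snd Ck_on_one_plus_sq)
  then have "Ck_on k S (\<lambda>p. sqrt (\<epsilon> * ((cmod (snd p))\<^sup>2 * (one_plus_sq p * one_plus_sq p) + T)))"
    using assms by (intro Ck_on_sqrt) (simp_all add: fibre_sq_def power_mult_distrib power2_eq_square[of "one_plus_sq _"])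
  then show ?thesis
    by (simp add: radial_def[abs_def] fibre_sq_def power_mult_distrib power2_eq_square[of "one_plus_sq _"])
qed

lemma Ck_on_eta: "open S \<Longrightarrow> Ck_on k S (\<lambda>p. eta p u)"
  unfolding eta_def
  by (intro Ck_on_add Ck_on_mult Ck_on_const Ck_on_cnj Ck_on_fst Ck_on_snd Ck_on_of_real Ck_on_one_plus_sq)

lemma smooth_eguchi_hanson:
  assumes "open S" "\<And>p. p \<in> S \<Longrightarrow> \<epsilon> * (fibre_sq p + T) > 0"
  shows "smooth_form_on S (eguchi_hanson \<epsilon> T)"
proof -
  have "radial \<epsilon> T p \<noteq> 0" if "p \<in> S" for p
    using radial_pos[OF assms(2)[OF that]] by simp
  then show ?thesis
    unfolding smooth_form_on_def smooth_on_def eguchi_hanson_def wedge_def divide_inverse power2_eq_square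
    using assms
    by (intro allI Ck_on_add Ck_on_diff Ck_on_mult Ck_on_const Ck_on_cnj Ck_on_of_real Ck_on_inverse
        Ck_on_radial Ck_on_one_plus_sq Ck_on_eta) auto
qed

section \<open>Reality, positivity and nondegeneracy\<close>

lemma imaginary_wedge_cnj:
  "\<i> * wedge \<theta> (\<lambda>w. cnj (\<theta> w)) u v = complex_of_real (2 * Im (cnj (\<theta> u) * \<theta> v))"
  by (simp add: wedge_def complex_eq_iff)

lemma dz1_bar_eq: "dz1_bar = (\<lambda>w. cnj (dz1 w))"
  by (simp add: fun_eq_iff dz1_bar_def dz1_def)

lemma eguchi_hanson_eq_of_real:
  "eguchi_hanson \<epsilon> T p u v = complex_of_real (2 * (radial \<epsilon> T p / (one_plus_sq p)\<^sup>2 * Im (cnj (fst u) * fst v)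
       + \<epsilon> / (4 * radial \<epsilon> T p) * Im (cnj (eta p u) * eta p v)))"
proof -
  have "eguchi_hanson \<epsilon> T p u v =
      complex_of_real (radial \<epsilon> T p / (one_plus_sq p)\<^sup>2) * (\<i> * wedge dz1 (\<lambda>w. cnj (dz1 w)) u v)
       + complex_of_real (\<epsilon> / (4 * radial \<epsilon> T p)) * (\<i> * wedge (eta p) (\<lambda>w. cnj (eta p w)) u v)"
    by (simp add: eguchi_hanson_def dz1_bar_eq algebra_simps)
  then show ?thesis
    unfolding imaginary_wedge_cnj dz1_def by (simp only: of_real_mult[symmetric] of_real_add[symmetric])
      (simp add: algebra_simps)
qed

lemma real_eguchi_hanson: "real_form_on S (eguchi_hanson \<epsilon> T)"
  by (simp add: real_form_on_def eguchi_hanson_eq_of_real del: of_real_mult of_real_add of_real_divide)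

text \<open>Expanding \<open>\<eta> \<and> cnj \<eta>\<close> gives back the four coefficients in which \<^const>\<open>omega\<close> is written.\<close>

lemma eguchi_hanson_form11:
  "eguchi_hanson \<epsilon> T p = form11
     (complex_of_real (radial \<epsilon> T p / (one_plus_sq p)\<^sup>2 + \<epsilon> * (cmod (snd p))\<^sup>2 * (cmod (fst p))\<^sup>2 / radial \<epsilon> T p))
     (complex_of_real (\<epsilon> * one_plus_sq p / (2 * radial \<epsilon> T p)) * (cnj (fst p) * snd p))
     (complex_of_real (\<epsilon> * one_plus_sq p / (2 * radial \<epsilon> T p)) * (fst p * cnj (snd p)))
     (complex_of_real (\<epsilon> * (one_plus_sq p)\<^sup>2 / (4 * radial \<epsilon> T p)))" (is "_ = ?F")
proof (intro ext)
  fix u v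
  define k where "k = complex_of_real (\<epsilon> / (4 * radial \<epsilon> T p))"
  have k: "complex_of_real (\<epsilon> * (cmod (snd p))\<^sup>2 * (cmod (fst p))\<^sup>2 / radial \<epsilon> T p)
      = 4 * k * (snd p * cnj (snd p)) * (fst p * cnj (fst p))"
    "complex_of_real (\<epsilon> * one_plus_sq p / (2 * radial \<epsilon> T p)) = 2 * k * complex_of_real (one_plus_sq p)"
    "complex_of_real (\<epsilon> * (one_plus_sq p)\<^sup>2 / (4 * radial \<epsilon> T p)) = k * (complex_of_real (one_plus_sq p))\<^sup>2"
    by (simp_all add: k_def complex_norm_square[symmetric])
  show "eguchi_hanson \<epsilon> T p u v = ?F u v"
    unfolding of_real_add k eguchi_hanson_def form11_def k_def[symmetric] wedge_def eta_def dz1_def dz2_def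
      dz1_bar_def dz2_bar_def complex_cnj_add complex_cnj_mult complex_cnj_cnj complex_cnj_complex_of_real
      complex_cnj_numeral
    by algebra
qed

text \<open>In the coframe \<open>d\<alpha>, \<eta>\<close> the form is diagonal with signs 1 and \<open>\<epsilon>\<close>. Multiplying the value of \<open>d\<alpha>\<close> on u
  by \<open>\<i>\<close> and that of \<open>\<eta>\<close> by \<open>\<epsilon> \<i>\<close> therefore makes both contributions nonnegative, and they vanish together only
  for \<open>u = 0\<close>. For \<open>\<epsilon> = 1\<close> the resulting
  vector is \<open>J u\<close>, which gives positivity; in general it still witnesses nondegeneracy.\<close>

lemma eguchi_hanson_test_vector:
  assumes "\<epsilon> * (fibre_sq p + T) > 0" "\<bar>\<epsilon>\<bar> = 1" "u \<noteq> 0" "fst v = \<i> * fst u" "eta p v = complex_of_real \<epsilon> * \<i> * eta p u"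
  shows "Re (eguchi_hanson \<epsilon> T p u v) > 0"
proof -
  let ?r = "radial \<epsilon> T p"
  have r: "?r > 0" using radial_pos assms(1) .
  have \<epsilon>: "\<epsilon> * \<epsilon> = 1" using assms(2) by (metis abs_mult_self_eq mult_1)
  have "Re (eguchi_hanson \<epsilon> T p u v) = 2 * (?r / (one_plus_sq p)\<^sup>2 * (cmod (fst u))\<^sup>2 + (\<epsilon> * \<epsilon>) / (4 * ?r) * (cmod (eta p u))\<^sup>2)"
    unfolding eguchi_hanson_eq_of_real assms(4,5) cmod_sq by (simp add: algebra_simps)
  also have "\<dots> > 0"
  proof (cases "fst u = 0")
    case True
    then have "eta p u \<noteq> 0" using assms(3) by (auto simp: eta_def prod_eq_iff)
    then show ?thesis using r \<epsilon> True by simp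
  next
    case False
    then show ?thesis using r \<epsilon> by (intro mult_pos_pos add_pos_nonneg) auto
  qed
  finally show ?thesis .
qed

lemma positive_eguchi_hanson:
  assumes "\<And>p. p \<in> S \<Longrightarrow> fibre_sq p + T > 0"
  shows "positive_form_on S (eguchi_hanson 1 T)"
  unfolding positive_form_on_def
  using assms by (auto intro!: eguchi_hanson_test_vector simp: Jmult_def eta_def algebra_simps)

lemma nondegenerate_eguchi_hanson:
  assumes "\<bar>\<epsilon>\<bar> = 1" "\<And>p. p \<in> S \<Longrightarrow> \<epsilon> * (fibre_sq p + T) > 0"
  shows "nondegenerate_form_on S (eguchi_hanson \<epsilon> T)"
  unfolding nondegenerate_form_on_def
proof (intro ballI allI impI)
  fix p u assume p: "p \<in> S" and u: "u \<noteq> (0 :: C2)"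
  \<comment> \<open>the vector with prescribed values of \<open>d\<alpha>\<close> and \<open>\<eta>\<close>, solved for its second component\<close>
  define v where "v = (\<i> * fst u, (complex_of_real \<epsilon> * \<i> * eta p u
       - 2 * (cnj (fst p) * snd p) * (\<i> * fst u)) / complex_of_real (one_plus_sq p))"
  have "eta p v = complex_of_real \<epsilon> * \<i> * eta p u"
    unfolding eta_def[of p v] by (simp add: v_def)
  then have "Re (eguchi_hanson \<epsilon> T p u v) > 0"
    using assms p u by (intro eguchi_hanson_test_vector) (simp_all add: v_def)
  then show "\<exists>v. eguchi_hanson \<epsilon> T p u v \<noteq> 0"
    by (metis less_irrefl zero_complex.sel(1))
qed

section \<open>Closedness\<close>

lemma ext_deriv_eq:
  assumes "\<And>v w. ((\<lambda>q. \<omega> q v w) has_derivative (\<lambda>u. D u v w)) (at p)"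
  shows "ext_deriv \<omega> p u v w = D u v w - D v u w + D w u v"
  by (simp add: ext_deriv_def frechet_derivative_at[OF assms, symmetric])

definition d_one_plus_sq :: "C2 \<Rightarrow> C2 \<Rightarrow> real"
  where "d_one_plus_sq p u = 2 * Re (cnj (fst p) * fst u)"

definition d_eta :: "C2 \<Rightarrow> C2 \<Rightarrow> C2 \<Rightarrow> complex"
  where "d_eta p u v = complex_of_real (d_one_plus_sq p u) * snd v
     + 2 * (cnj (fst p) * snd u + cnj (fst u) * snd p) * fst v"

text \<open>The derivative of \<^const>\<open>fibre_sq\<close> is written as \<open>(1 + |\<alpha>|\<^sup>2) (cnj \<beta> \<eta> + \<beta> cnj \<eta>)\<close>: being a combination of
  \<open>\<eta>\<close> and \<open>cnj \<eta>\<close>, it is killed by the wedge product with \<open>\<eta> \<and> cnj \<eta>\<close>.\<close>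

definition d_fibre_sq :: "C2 \<Rightarrow> C2 \<Rightarrow> real"
  where "d_fibre_sq p u = 2 * one_plus_sq p * Re (cnj (snd p) * eta p u)"

lemma one_plus_sq_has_derivative: "(one_plus_sq has_derivative d_one_plus_sq p) (at p)"
  unfolding one_plus_sq_def[abs_def] cmod_sq
  by (rule has_derivative_eq_rhs, (rule derivative_intros)+)
    (simp add: fun_eq_iff d_one_plus_sq_def algebra_simps)

lemma fibre_sq_has_derivative: "(fibre_sq has_derivative d_fibre_sq p) (at p)"
proof -
  have eq: "fibre_sq = (\<lambda>p. (Re (snd p) * Re (snd p) + Im (snd p) * Im (snd p)) * (one_plus_sq p * one_plus_sq p))"
    by (simp add: fun_eq_iff fibre_sq_def power_mult_distrib cmod_sq power2_eq_square[of "one_plus_sq _"])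
  have "Re (cnj (snd p) * eta p u) = one_plus_sq p * (Re (snd p) * Re (snd u) + Im (snd p) * Im (snd u))
      + (Re (snd p) * Re (snd p) + Im (snd p) * Im (snd p)) * d_one_plus_sq p u" for u
    by (simp add: eta_def d_one_plus_sq_def distrib_left distrib_right right_diff_distrib left_diff_distrib)
  then have d: "d_fibre_sq p = (\<lambda>u. 2 * one_plus_sq p *
      (one_plus_sq p * (Re (snd p) * Re (snd u) + Im (snd p) * Im (snd u))
      + (Re (snd p) * Re (snd p) + Im (snd p) * Im (snd p)) * d_one_plus_sq p u))"
    by (simp only: d_fibre_sq_def[abs_def])
  show ?thesis unfolding eq d
    by (rule has_derivative_eq_rhs,
        (rule has_derivative_mult has_derivative_add has_derivative_Re has_derivative_Im
          has_derivative_snd has_derivative_ident one_plus_sq_has_derivative)+, rule ext)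
      (simp add: distrib_left distrib_right)
qed

lemma radial_has_derivative:
  assumes "\<epsilon> * (fibre_sq p + T) > 0"
  shows "(radial \<epsilon> T has_derivative (\<lambda>u. \<epsilon> * d_fibre_sq p u / (2 * radial \<epsilon> T p))) (at p)"
proof -
  have "((\<lambda>q. \<epsilon> * (fibre_sq q + T)) has_derivative (\<lambda>u. \<epsilon> * (d_fibre_sq p u + 0))) (at p)"
    by (rule has_derivative_mult_right has_derivative_add fibre_sq_has_derivative has_derivative_const)+
  from has_derivative_compose[OF this DERIV_real_sqrt[OF assms, unfolded has_field_derivative_def]]
  show ?thesis
    unfolding radial_def[symmetric] radial_def[symmetric, abs_def]
    by (rule has_derivative_eq_rhs) (simp add: fun_eq_iff field_simps)
qed

lemma eta_has_derivative: "((\<lambda>q. eta q v) has_derivative (\<lambda>u. d_eta p u v)) (at p)"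
  unfolding eta_def
  by (rule has_derivative_eq_rhs,
      (rule has_derivative_mult has_derivative_add has_derivative_cnj has_derivative_of_real
        has_derivative_const has_derivative_fst has_derivative_snd has_derivative_ident one_plus_sq_has_derivative)+)
    (simp add: fun_eq_iff d_eta_def distrib_left distrib_right)

definition d_eguchi_hanson :: "real \<Rightarrow> real \<Rightarrow> C2 \<Rightarrow> C2 \<Rightarrow> C2 \<Rightarrow> C2 \<Rightarrow> complex"
  where "d_eguchi_hanson \<epsilon> T p u v w =
    \<i> * (complex_of_real (\<epsilon> * d_fibre_sq p u / (2 * radial \<epsilon> T p * (one_plus_sq p)\<^sup>2)
           - 2 * radial \<epsilon> T p * d_one_plus_sq p u / one_plus_sq p ^ 3) * wedge dz1 dz1_bar v w
       - complex_of_real (d_fibre_sq p u / (8 * radial \<epsilon> T p ^ 3)) * wedge (eta p) (\<lambda>w. cnj (eta p w)) v w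
       + complex_of_real (\<epsilon> / (4 * radial \<epsilon> T p))
         * (d_eta p u v * cnj (eta p w) + eta p v * cnj (d_eta p u w)
            - (d_eta p u w * cnj (eta p v) + eta p w * cnj (d_eta p u v))))"

text \<open>Here \<open>\<epsilon>\<^sup>2 = 1\<close> makes the derivative of \<open>\<epsilon> / \<rho>\<close>, with \<open>\<rho>\<close> = \<^const>\<open>radial\<close>, equal to \<open>- ds / (2 \<rho>\<^sup>3)\<close> for both signs.\<close>

lemma eguchi_hanson_has_derivative:
  assumes pos: "\<epsilon> * (fibre_sq p + T) > 0" and "\<bar>\<epsilon>\<bar> = 1"
  shows "((\<lambda>q. eguchi_hanson \<epsilon> T q v w) has_derivative (\<lambda>u. d_eguchi_hanson \<epsilon> T p u v w)) (at p)"
proof -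
  have \<epsilon>: "\<epsilon> * \<epsilon> = 1" using assms(2) by (metis abs_mult_self_eq mult_1)
  have r: "radial \<epsilon> T p \<noteq> 0" using radial_pos[OF pos] by simp
  have A: "((\<lambda>q. radial \<epsilon> T q / (one_plus_sq q)\<^sup>2) has_derivative
      (\<lambda>u. \<epsilon> * d_fibre_sq p u / (2 * radial \<epsilon> T p * (one_plus_sq p)\<^sup>2)
           - 2 * radial \<epsilon> T p * d_one_plus_sq p u / one_plus_sq p ^ 3)) (at p)"
    unfolding power2_eq_square[of "one_plus_sq _"]
    by (rule has_derivative_eq_rhs, (rule has_derivative_divide' has_derivative_mult
          radial_has_derivative[OF pos] one_plus_sq_has_derivative)+)
      (simp_all add: fun_eq_iff r field_simps power3_eq_cube)
  have B: "((\<lambda>q. \<epsilon> / (4 * radial \<epsilon> T q)) has_derivative (\<lambda>u. - (d_fibre_sq p u / (8 * radial \<epsilon> T p ^ 3)))) (at p)"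
    by (rule has_derivative_eq_rhs, (rule has_derivative_divide' has_derivative_mult has_derivative_const
          radial_has_derivative[OF pos])+)
      (use r \<epsilon> in \<open>simp_all add: fun_eq_iff field_simps power3_eq_cube\<close>)
  show ?thesis
    unfolding eguchi_hanson_def wedge_def
    by (rule has_derivative_eq_rhs, (rule A B has_derivative_mult has_derivative_add has_derivative_diff
          has_derivative_cnj has_derivative_of_real has_derivative_const eta_has_derivative)+)
      (simp add: fun_eq_iff d_eguchi_hanson_def wedge_def algebra_simps)
qed

text \<open>Put \<open>n = 1 + |\<alpha>|\<^sup>2\<close>. The exterior derivative splits by powers of \<open>\<rho>\<close> = \<^const>\<open>radial\<close> into three parts,
  proportional to \<open>\<rho> dn \<and> d\<alpha> \<and> d cnj \<alpha>\<close>, to \<open>\<rho>\<^sup>-\<^sup>3 ds \<and> \<eta> \<and> cnj \<eta>\<close> and to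
  \<open>\<rho>\<^sup>-\<^sup>1 (2 n\<^sup>-\<^sup>2 ds \<and> d\<alpha> \<and> d cnj \<alpha> + d(\<eta> \<and> cnj \<eta>))\<close>. The first two vanish because the factor \<open>dn\<close> or \<open>ds\<close> lies in
  the span of the other two factors; in the third the two terms cancel. Evaluated on three vectors, these are
  the polynomial identities proved below.\<close>

lemma closed_eguchi_hanson:
  assumes "\<bar>\<epsilon>\<bar> = 1" "\<And>p. p \<in> S \<Longrightarrow> \<epsilon> * (fibre_sq p + T) > 0"
  shows "closed_form_on S (eguchi_hanson \<epsilon> T)"
  unfolding closed_form_on_def
proof (intro ballI allI)
  fix p u v w
  assume "p \<in> S"
  then have ext: "ext_deriv (eguchi_hanson \<epsilon> T) p u v w = d_eguchi_hanson \<epsilon> T p u v w - d_eguchi_hanson \<epsilon> T p v u w + d_eguchi_hanson \<epsilon> T p w u v"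
    using assms by (intro ext_deriv_eq eguchi_hanson_has_derivative)
  define n where "n = 1 + fst p * cnj (fst p)"
  define r where "r = complex_of_real (radial \<epsilon> T p)"
  define e where "e = complex_of_real \<epsilon>"
  \<comment> \<open>the derivatives of s and of n; s' is divided by n, which turns the identities into polynomial ones\<close>
  define s' where "s' u = complex_of_real (Re (cnj (snd p) * eta p u)) * 2" for u
  define n' where "n' u = complex_of_real (d_one_plus_sq p u)" for u
  \<comment> \<open>W, V and V' stand for \<open>d\<alpha> \<and> d cnj \<alpha>\<close>, \<open>\<eta> \<and> cnj \<eta>\<close> and the derivative of the latter along u\<close>
  define W where "W v w = fst v * cnj (fst w) - fst w * cnj (fst v)" for v w :: C2
  define V where "V v w = eta p v * cnj (eta p w) - eta p w * cnj (eta p v)" for v w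
  define V' where "V' u v w = d_eta p u v * cnj (eta p w) + eta p v * cnj (d_eta p u w)
            - (d_eta p u w * cnj (eta p v) + eta p w * cnj (d_eta p u v))" for u v w
  have N: "complex_of_real (one_plus_sq p) = n"
    by (simp add: n_def of_real_one_plus_sq)
  have n: "n \<noteq> 0"
    by (simp flip: N)
  have s': "s' u = cnj (snd p) * eta p u + snd p * cnj (eta p u)" for u
    by (simp add: s'_def complex_eq_iff)
  have n': "n' u = cnj (fst p) * fst u + fst p * cnj (fst u)" for u
    by (simp add: n'_def d_one_plus_sq_def complex_eq_iff algebra_simps)
  have eta: "eta p u = n * snd u + 2 * (cnj (fst p) * snd p) * fst u" for u
    by (simp add: eta_def N)
  have eta_cnj: "cnj (eta p u) = n * cnj (snd u) + 2 * (fst p * cnj (snd p)) * cnj (fst u)" for u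
    by (simp add: eta_def flip: N)
  have d_eta: "d_eta p u v = n' u * snd v + 2 * (cnj (fst p) * snd u + cnj (fst u) * snd p) * fst v" for u v
    by (simp add: d_eta_def n'_def)
  have d_eta_cnj: "cnj (d_eta p u v) = n' u * cnj (snd v) + 2 * (fst p * cnj (snd u) + fst u * cnj (snd p)) * cnj (fst v)" for u v
    by (simp add: d_eta_def n'_def)
  have ds: "complex_of_real (d_fibre_sq p u) = n * s' u" for u
    by (simp add: d_fibre_sq_def s'_def N)
  have d: "d_eguchi_hanson \<epsilon> T p u v w = \<i> * ((e / (2 * r) * (s' u / n) - 2 * r / n ^ 3 * n' u) * W v w
      - n / (8 * r ^ 3) * (s' u * V v w) + e / (4 * r) * V' u v w)" for u v w
    unfolding d_eguchi_hanson_def W_def V_def V'_def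
    using n by (simp add: wedge_def dz1_def dz1_bar_def ds N power2_eq_square mult.assoc flip: r_def e_def n'_def)
  \<comment> \<open>no \<open>\<rho>\<close>-dependence is left: one vanishing alternating sum for each power of \<open>\<rho>\<close>\<close>
  have I1: "n' u * W v w - n' v * W u w + n' w * W u v = 0"
    unfolding n' W_def by algebra
  have I2: "s' u * V v w - s' v * V u w + s' w * V u v = 0"
    unfolding s' V_def by algebra
  have I3': "2 * (s' u * W v w - s' v * W u w + s' w * W u v) + n * (V' u v w - V' v u w + V' w u v) = 0"
    unfolding s' V'_def W_def eta_cnj d_eta_cnj unfolding eta d_eta n' n_def by algebra
  define k where "k = e / (4 * r * n)"
  have k: "e / (2 * r) * (x / n) = 2 * k * x" "e / (4 * r) = k * n" for x
    using n by (simp_all add: k_def)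
  have "ext_deriv (eguchi_hanson \<epsilon> T) p u v w = \<i> * (k *
        (2 * (s' u * W v w - s' v * W u w + s' w * W u v) + n * (V' u v w - V' v u w + V' w u v))
      - 2 * r / n ^ 3 * (n' u * W v w - n' v * W u w + n' w * W u v)
      - n / (8 * r ^ 3) * (s' u * V v w - s' v * V u w + s' w * V u v))"
    unfolding ext d k by (simp only: ring_distribs mult_ac diff_conv_add_uminus minus_add_distrib mult_minus_right mult_minus_left minus_minus add_ac)
  then show "ext_deriv (eguchi_hanson \<epsilon> T) p u v w = 0"
    unfolding I1 I2 I3' by simp
qed

section \<open>Forms in exchanged coordinates\<close>

lemma bounded_linear_swap: "bounded_linear (prod.swap :: C2 \<Rightarrow> C2)"
  unfolding prod.swap_def by (intro bounded_linear_Pair bounded_linear_snd bounded_linear_fst)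

lemma pullback_swap: "pullback prod.swap \<omega> p u v = \<omega> (prod.swap p) (prod.swap u) (prod.swap v)"
  by (simp add: pullback_def flip: frechet_derivative_at[OF bounded_linear_imp_has_derivative[OF bounded_linear_swap]])

lemma smooth_form_on_swap:
  "open S \<Longrightarrow> smooth_form_on S \<omega> \<Longrightarrow> smooth_form_on (prod.swap -` S) (pullback prod.swap \<omega>)"
  by (auto simp: smooth_form_on_def smooth_on_def pullback_swap
      intro: Ck_on_comp_bounded_linear[OF _ bounded_linear_swap])

lemma real_form_on_swap: "real_form_on S \<omega> \<Longrightarrow> real_form_on (prod.swap -` S) (pullback prod.swap \<omega>)"
  by (auto simp: real_form_on_def pullback_swap)

lemma closed_form_on_swap:
  assumes "smooth_form_on S \<omega>" "closed_form_on S \<omega>"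
  shows "closed_form_on (prod.swap -` S) (pullback prod.swap \<omega>)"
  unfolding closed_form_on_def
proof (intro ballI allI)
  fix p u v w
  assume p: "p \<in> prod.swap -` S"
  have "((\<lambda>q. pullback prod.swap \<omega> q v w) has_derivative
      (\<lambda>u. frechet_derivative (\<lambda>q. \<omega> q (prod.swap v) (prod.swap w)) (at (prod.swap p)) (prod.swap u))) (at p)" for v w
  proof -
    have "Ck_on (Suc 0) S (\<lambda>q. \<omega> q (prod.swap v) (prod.swap w))"
      using assms(1) unfolding smooth_form_on_def smooth_on_def by blast
    from Ck_on_Suc_has_derivative[OF this, of "prod.swap p"] p show ?thesis
      unfolding pullback_swap
      by (intro has_derivative_compose[OF bounded_linear_imp_has_derivative[OF bounded_linear_swap]]) simp
  qed
  from ext_deriv_eq[where D = "\<lambda>u v w. frechet_derivative (\<lambda>q. \<omega> q (prod.swap v) (prod.swap w)) (at (prod.swap p)) (prod.swap u)",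
      OF this, of u v w]
  have "ext_deriv (pullback prod.swap \<omega>) p u v w = ext_deriv \<omega> (prod.swap p) (prod.swap u) (prod.swap v) (prod.swap w)"
    by (simp add: ext_deriv_def)
  then show "ext_deriv (pullback prod.swap \<omega>) p u v w = 0"
    using assms(2) p unfolding closed_form_on_def by (metis vimageD)
qed

lemma form11_swap: "form11 a b c d (prod.swap u) (prod.swap v) = form11 d c b a u v"
  by (simp add: form11_def wedge_def dz1_def dz2_def dz1_bar_def dz2_bar_def algebra_simps)

lemma has_coeffs_on_swap:
  "has_coeffs_on S \<omega> g11 g12 g21 g22 \<Longrightarrow>
    has_coeffs_on (prod.swap -` S) (pullback prod.swap \<omega>) (\<lambda>p. g22 (prod.swap p)) (\<lambda>p. g21 (prod.swap p))
      (\<lambda>p. g12 (prod.swap p)) (\<lambda>p. g11 (prod.swap p))"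
  unfolding has_coeffs_on_def
  by (intro ballI ext) (simp only: pullback_swap vimage_eq form11_swap)

lemma positive_form_on_swap:
  "positive_form_on S \<omega> \<Longrightarrow> positive_form_on (prod.swap -` S) (pullback prod.swap \<omega>)"
  unfolding positive_form_on_def
proof (intro ballI allI impI)
  fix p u
  assume *: "\<forall>p\<in>S. \<forall>u. u \<noteq> 0 \<longrightarrow> Re (\<omega> p u (Jmult u)) > 0" "p \<in> prod.swap -` S" "u \<noteq> (0::C2)"
  have "prod.swap u \<noteq> 0" "prod.swap (Jmult u) = Jmult (prod.swap u)"
    using *(3) by (auto simp: Jmult_def prod_eq_iff)
  then show "Re (pullback prod.swap \<omega> p u (Jmult u)) > 0"
    unfolding pullback_swap using * by (metis vimageD)
qed

lemma nondegenerate_form_on_swap: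
  "nondegenerate_form_on S \<omega> \<Longrightarrow> nondegenerate_form_on (prod.swap -` S) (pullback prod.swap \<omega>)"
  unfolding nondegenerate_form_on_def
proof (intro ballI allI impI)
  fix p u
  assume *: "\<forall>p\<in>S. \<forall>u. u \<noteq> 0 \<longrightarrow> (\<exists>v. \<omega> p u v \<noteq> 0)" "p \<in> prod.swap -` S" "u \<noteq> (0::C2)"
  have "prod.swap u \<noteq> 0"
    using *(3) by (auto simp: prod_eq_iff)
  with * obtain v where "\<omega> (prod.swap p) (prod.swap u) v \<noteq> 0"
    by (metis vimageD)
  then have "pullback prod.swap \<omega> p u (prod.swap v) \<noteq> 0"
    by (simp add: pullback_swap)
  then show "\<exists>v. pullback prod.swap \<omega> p u v \<noteq> 0" ..
qed

section \<open>Invariance under the change of charts\<close>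

definition d_transition :: "C2 \<Rightarrow> C2 \<Rightarrow> C2"
  where "d_transition p u = (2 * fst p * snd p * fst u + (fst p)\<^sup>2 * snd u, - fst u / (fst p)\<^sup>2)"

lemma transition_has_derivative:
  assumes "fst p \<noteq> 0"
  shows "(transition has_derivative d_transition p) (at p)"
  unfolding transition_def[abs_def] power2_eq_square
  by (rule has_derivative_eq_rhs, (rule has_derivative_Pair has_derivative_mult Deriv.has_derivative_inverse
        has_derivative_fst has_derivative_snd has_derivative_ident assms)+)
    (simp add: fun_eq_iff d_transition_def power2_eq_square field_simps assms)

lemma Im_cnj_mult_scale: "Im (cnj (c * x) * (c * y)) = (cmod c)\<^sup>2 * Im (cnj x * y)"
  by (simp add: cmod_sq algebra_simps)

text \<open>The form looks the same in both charts once the fibre coordinate is put second. In the coordinates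
  \<open>(1 / \<alpha>, \<alpha>\<^sup>2 \<beta>)\<close> the function s is unchanged, \<open>d\<alpha>\<close> is multiplied by \<open>- 1 / \<alpha>\<^sup>2\<close>, whose effect is absorbed by the
  factor \<open>(1 + |\<alpha>|\<^sup>2)\<^sup>-\<^sup>2\<close>, and \<open>\<eta>\<close> is multiplied by the phase \<open>\<alpha> / cnj \<alpha>\<close>.\<close>

lemma eguchi_hanson_transition:
  assumes a: "fst p \<noteq> 0"
  shows "eguchi_hanson \<epsilon> T p = pullback transition (pullback prod.swap (eguchi_hanson \<epsilon> T)) p"
proof (intro ext)
  fix u v
  define q where "q = prod.swap (transition p)"
  define x where "x = (cmod (fst p))\<^sup>2"
  define D where "D u = prod.swap (d_transition p u)" for u
  have x: "x > 0" and x1: "1 + x > 0" using a by (auto simp: x_def add_pos_pos)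
  have N: "one_plus_sq p = 1 + x" "one_plus_sq q = (1 + x) / x"
    using x by (auto simp: one_plus_sq_def q_def transition_def x_def norm_inverse norm_divide field_simps)
  have "cmod (snd q) = x * cmod (snd p)"
    by (simp add: q_def transition_def x_def norm_mult norm_power)
  then have r: "radial \<epsilon> T q = radial \<epsilon> T p"
    using x by (simp add: radial_def fibre_sq_def N)
  have D1: "fst (D u) = - 1 / (fst p)\<^sup>2 * fst u" for u
    by (simp add: D_def d_transition_def)
  have D2: "eta q (D u) = fst p / cnj (fst p) * eta p u" for u
    using a by (simp add: eta_def of_real_one_plus_sq D_def d_transition_def q_def transition_def
        field_simps power2_eq_square)
  have c: "(cmod (- 1 / (fst p)\<^sup>2))\<^sup>2 = 1 / x\<^sup>2" "(cmod (fst p / cnj (fst p)))\<^sup>2 = 1"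
    using a by (simp_all add: norm_divide norm_power x_def power_divide)
  have "eguchi_hanson \<epsilon> T q (D u) (D v) = eguchi_hanson \<epsilon> T p u v"
    unfolding eguchi_hanson_eq_of_real D1 D2 Im_cnj_mult_scale c r N
    using x x1 by (simp add: power_divide)
  moreover have "pullback transition (pullback prod.swap (eguchi_hanson \<epsilon> T)) p u v = eguchi_hanson \<epsilon> T q (D u) (D v)"
    by (simp add: pullback_def[of transition] pullback_swap q_def D_def
        flip: frechet_derivative_at[OF transition_has_derivative[OF a]])
  ultimately show "eguchi_hanson \<epsilon> T p u v = pullback transition (pullback prod.swap (eguchi_hanson \<epsilon> T)) p u v"
    by simp
qed

section \<open>The global forms on the regions where they are regular\<close>

text \<open>The choices \<open>\<epsilon> = 1\<close> and \<open>\<epsilon> = -1\<close> give the two sides of the circle bundle on which R vanishes. This bundle is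
  empty for \<open>T > 0\<close> and shrinks to the zero section for \<open>T = 0\<close>.\<close>

definition region :: "real \<Rightarrow> real \<Rightarrow> X2 set"
  where "region \<epsilon> T = {x. \<epsilon> * ((fibre_norm x)\<^sup>2 + T) > 0}"

definition eguchi_hanson_X2 :: "real \<Rightarrow> real \<Rightarrow> X2_form"
  where "eguchi_hanson_X2 \<epsilon> T = (eguchi_hanson \<epsilon> T, pullback prod.swap (eguchi_hanson \<epsilon> T))"

lemma chart1_region: "chart1 -` region \<epsilon> T = {p. \<epsilon> * (fibre_sq p + T) > 0}"
proof -
  have "fibre_norm (chart1 p) = cmod (snd p) * one_plus_sq p" for p
    unfolding one_plus_sq_def by transfer simp
  then show ?thesis
    by (auto simp: region_def fibre_sq_def)
qed

lemma chart2_region: "chart2 -` region \<epsilon> T = prod.swap -` chart1 -` region \<epsilon> T"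
proof -
  have "fibre_norm (chart2 p) = cmod (fst p) * one_plus_sq (prod.swap p)" for p
    unfolding one_plus_sq_def prod.swap_def fst_conv by transfer simp
  then show ?thesis
    unfolding chart1_region by (auto simp: region_def fibre_sq_def)
qed

lemma open_chart1_region: "open (chart1 -` region \<epsilon> T)"
  unfolding chart1_region fibre_sq_def one_plus_sq_def
  by (intro open_Collect_less continuous_intros)

lemma open_region: "open (region \<epsilon> T)"
  unfolding open_X2_def chart2_region
  by (intro conjI open_chart1_region open_vimage linear_continuous_on bounded_linear_swap)

lemma has_coeffs_on_eguchi_hanson:
  "has_coeffs_on S (eguchi_hanson \<epsilon> T)
     (\<lambda>p. complex_of_real (radial \<epsilon> T p / (one_plus_sq p)\<^sup>2 + \<epsilon> * (cmod (snd p))\<^sup>2 * (cmod (fst p))\<^sup>2 / radial \<epsilon> T p))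
     (\<lambda>p. complex_of_real (\<epsilon> * one_plus_sq p / (2 * radial \<epsilon> T p)) * (cnj (fst p) * snd p))
     (\<lambda>p. complex_of_real (\<epsilon> * one_plus_sq p / (2 * radial \<epsilon> T p)) * (fst p * cnj (snd p)))
     (\<lambda>p. complex_of_real (\<epsilon> * (one_plus_sq p)\<^sup>2 / (4 * radial \<epsilon> T p)))"
  unfolding has_coeffs_on_def by (intro ballI eguchi_hanson_form11)

lemma smooth_real_closed_11_eguchi_hanson:
  assumes "\<bar>\<epsilon>\<bar> = 1"
  shows "smooth_real_closed_11_on (region \<epsilon> T) (eguchi_hanson_X2 \<epsilon> T)"
proof -
  let ?S = "chart1 -` region \<epsilon> T"
  have S: "\<epsilon> * (fibre_sq p + T) > 0" if "p \<in> ?S" for p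
    using that by (simp add: chart1_region)
  have sm: "smooth_form_on ?S (eguchi_hanson \<epsilon> T)"
    by (rule smooth_eguchi_hanson[OF open_chart1_region S])
  have cl: "closed_form_on ?S (eguchi_hanson \<epsilon> T)"
    by (rule closed_eguchi_hanson[OF assms S])
  have "type11_on ?S (eguchi_hanson \<epsilon> T)" "type11_on (prod.swap -` ?S) (pullback prod.swap (eguchi_hanson \<epsilon> T))"
    unfolding type11_on_def using has_coeffs_on_eguchi_hanson has_coeffs_on_swap by blast+
  moreover have "compatible_on (region \<epsilon> T) (eguchi_hanson_X2 \<epsilon> T)"
    using eguchi_hanson_transition by (simp add: compatible_on_def eguchi_hanson_X2_def)
  ultimately show ?thesis
    unfolding smooth_real_closed_11_on_def eguchi_hanson_X2_def chart2_region
    using open_region sm cl smooth_form_on_swap[OF open_chart1_region sm] closed_form_on_swap[OF sm cl]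
      real_eguchi_hanson real_form_on_swap[OF real_eguchi_hanson[of ?S]]
    by simp
qed

lemma kaehler_eguchi_hanson: "kaehler_on (region 1 T) (eguchi_hanson_X2 1 T)"
  unfolding kaehler_on_def chart2_region
  using smooth_real_closed_11_eguchi_hanson[of 1 T] positive_eguchi_hanson[of "chart1 -` region 1 T" T]
  by (simp add: eguchi_hanson_X2_def chart1_region positive_form_on_swap del: vimage_Collect_eq)

lemma pseudo_kaehler_eguchi_hanson: "\<bar>\<epsilon>\<bar> = 1 \<Longrightarrow> pseudo_kaehler_on (region \<epsilon> T) (eguchi_hanson_X2 \<epsilon> T)"
  unfolding pseudo_kaehler_on_def chart2_region
  using smooth_real_closed_11_eguchi_hanson[of \<epsilon> T] nondegenerate_eguchi_hanson[of \<epsilon> "chart1 -` region \<epsilon> T" T]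
  by (simp add: eguchi_hanson_X2_def chart1_region nondegenerate_form_on_swap del: vimage_Collect_eq)

section \<open>Identification with the given family\<close>

lemma omega_form11:
  assumes "r = R T (fst p) (snd p)" "n = complex_of_real (one_plus_sq p)"
  shows "omega T p = form11
     (r / n\<^sup>2 + complex_of_real ((cmod (snd p))\<^sup>2 * (cmod (fst p))\<^sup>2) / r)
     (n / (2 * r) * (cnj (fst p) * snd p)) (n / (2 * r) * (fst p * cnj (snd p))) (n\<^sup>2 / (4 * r))"
proof -
  have n: "1 + complex_of_real ((cmod (fst p))\<^sup>2) = n"
    by (simp only: assms(2) one_plus_sq_def of_real_add of_real_1)
  have "n \<noteq> 0"
    by (simp add: assms(2))
  then have "1 / n\<^sup>2 * (r + complex_of_real ((cmod (snd p))\<^sup>2) * n\<^sup>2 * complex_of_real ((cmod (fst p))\<^sup>2) / r)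
      = r / n\<^sup>2 + complex_of_real ((cmod (snd p))\<^sup>2 * (cmod (fst p))\<^sup>2) / r"
    by (simp add: distrib_left)
  then show ?thesis
    unfolding omega_def Let_def n assms(1)[symmetric] by (simp only:)
qed

lemma omega_eq_eguchi_hanson:
  assumes "fibre_sq p + T > 0"
  shows "omega T p = eguchi_hanson 1 T p"
proof -
  have "complex_of_real (radial 1 T p) = R T (fst p) (snd p)"
    using assms by (simp add: R_def radial_def fibre_sq_def one_plus_sq_def power_mult_distrib csqrt_of_real_nonneg)
  from omega_form11[OF this refl] show ?thesis
    using eguchi_hanson_form11[of 1 T p] assms by simp
qed

lemma form11_scale: "form11 (c * g11) (c * g12) (c * g21) (c * g22) u v = c * form11 g11 g12 g21 g22 u v"
  by (simp add: form11_def algebra_simps)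

text \<open>With \<open>R = \<i> \<rho>\<close> one has \<open>1 / R = - \<i> / \<rho>\<close>: a factor \<open>\<i>\<close> comes out of every coefficient at the price of a sign
  in front of the terms that contain \<open>1 / \<rho>\<close>. This sign is the \<open>\<epsilon> = -1\<close> of the real form.\<close>

lemma omega_eq_imaginary_eguchi_hanson:
  assumes "fibre_sq p + T < 0"
  shows "omega T p u v = \<i> * eguchi_hanson (-1) T p u v"
proof -
  have "\<i> * complex_of_real (radial (-1) T p) = R T (fst p) (snd p)"
    using assms by (simp add: R_def radial_def fibre_sq_def one_plus_sq_def power_mult_distrib csqrt_of_real_nonpos)
  note omega = omega_form11[OF this refl]
  have i: "x / (\<i> * y) = \<i> * (- x / y)" "x / (k * (\<i> * y)) = \<i> * (- x / (k * y))" for x y k :: complex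
    by (simp_all add: complex_i_not_zero divide_simps)
  show ?thesis
    unfolding omega i using eguchi_hanson_form11[of "-1" T p] assms
    by (simp add: distrib_left right_diff_distrib mult.assoc flip: form11_scale)
qed

lemma omega_extends_eguchi_hanson: "extends_on (region 1 T) (omega T) (eguchi_hanson_X2 1 T)"
  unfolding extends_on_def chart1_region by (simp add: eguchi_hanson_X2_def omega_eq_eguchi_hanson)

lemma defines_kaehler_region: "defines_kaehler_metric_on (region 1 T) (omega T)"
  unfolding defines_kaehler_metric_on_def using omega_extends_eguchi_hanson kaehler_eguchi_hanson by blast

lemma defines_imaginary_region: "defines_imaginary_pseudo_kaehler_metric_on (region (-1) T) (omega T)"
proof -
  let ?H = "eguchi_hanson_X2 (-1) T"
  let ?\<Omega> = "(\<lambda>p u v. \<i> * fst ?H p u v, \<lambda>p u v. \<i> * snd ?H p u v)"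
  have "imaginary_pseudo_kaehler_on (region (-1) T) ?\<Omega>"
    unfolding imaginary_pseudo_kaehler_on_def by (intro exI[of _ ?H]) (simp add: pseudo_kaehler_eguchi_hanson)
  moreover have "extends_on (region (-1) T) (omega T) ?\<Omega>"
    unfolding extends_on_def chart1_region by (auto simp: eguchi_hanson_X2_def omega_eq_imaginary_eguchi_hanson fun_eq_iff)
  ultimately show ?thesis
    unfolding defines_imaginary_pseudo_kaehler_metric_on_def by blast
qed

section \<open>Behaviour along the zero section\<close>

lemma fibre_norm_nonneg: "fibre_norm x \<ge> 0"
  by transfer (auto split: sum.split)

lemma fibre_norm_eq_0_iff: "fibre_norm x = 0 \<longleftrightarrow> x \<in> zero_section"
proof -
  have "1 + (cmod z)\<^sup>2 \<noteq> 0" for z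
    by (smt (verit) zero_le_power2)
  then show ?thesis
    unfolding zero_section_def mem_Collect_eq by transfer (auto split: sum.split)
qed

lemma compl_zero_section: "- zero_section = region 1 0"
  using fibre_norm_eq_0_iff by (auto simp: region_def)

text \<open>For \<open>T = 0\<close> the fibre coefficient is \<open>(1 + |\<alpha>|\<^sup>2) / (4 |\<beta>|)\<close>, and the second chart is the first one with its
  coordinates exchanged.\<close>

lemma blows_up_eguchi_hanson: "blows_up_along_zero_section (eguchi_hanson_X2 1 0)"
proof -
  define g where "g p = (one_plus_sq p)\<^sup>2 / (4 * radial 1 0 p)" for p
  obtain g11 g12 g21 where g: "has_coeffs_on (chart1 -` region 1 0) (eguchi_hanson 1 0) g11 g12 g21 (\<lambda>p. complex_of_real (g p))"
    unfolding g_def using has_coeffs_on_eguchi_hanson[where \<epsilon> = 1 and T = 0, unfolded mult_1] by blast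
  have lim: "filterlim (\<lambda>\<beta>. g (\<alpha>, \<beta>)) at_top (at 0)" for \<alpha>
  proof -
    define n where "n = one_plus_sq (\<alpha>, 0)"
    have n: "n > 0"
      by (simp add: n_def)
    have N: "one_plus_sq (\<alpha>, \<beta>) = n" for \<beta>
      by (simp add: n_def one_plus_sq_def)
    have "radial 1 0 (\<alpha>, \<beta>) = norm \<beta> * n" for \<beta>
      using n by (simp add: radial_def fibre_sq_def N)
    then have "g (\<alpha>, \<beta>) = n / 4 * inverse (norm \<beta>)" for \<beta>
      using n by (cases "\<beta> = 0") (simp_all add: g_def N field_simps power2_eq_square)
    moreover have "filterlim (\<lambda>\<beta>. n / 4 * inverse (norm (\<beta>::complex))) at_top (at 0)"
      using n by (intro filterlim_tendsto_pos_mult_at_top[OF tendsto_const] filterlim_inverse_at_top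
          tendsto_norm_zero tendsto_ident_at) (simp_all add: eventually_at_filter)
    ultimately show ?thesis by (simp only:)
  qed
  have g': "has_coeffs_on (prod.swap -` chart1 -` region 1 0) (pullback prod.swap (eguchi_hanson 1 0))
      (\<lambda>p. complex_of_real (g (prod.swap p))) (\<lambda>p. g21 (prod.swap p)) (\<lambda>p. g12 (prod.swap p))
      (\<lambda>p. g11 (prod.swap p))"
    by (rule has_coeffs_on_swap[OF g])
  have lim': "filterlim (\<lambda>\<alpha>'. g (prod.swap (\<alpha>', \<beta>'))) at_top (at 0)" for \<beta>'
    using lim by simp
  show ?thesis
    unfolding blows_up_along_zero_section_def compl_zero_section chart2_region eguchi_hanson_X2_def fst_conv snd_conv
    by (rule conjI exI allI g lim g' lim')+
qed

section \<open>The three ranges of the parameter\<close>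

theorem mainTheorem5:
  shows "(\<forall>T>0. defines_kaehler_metric_on UNIV (omega T)) \<and>
    defines_kaehler_metric_blowing_up_along_zero_section (omega 0) \<and>
    (\<forall>b>0. defines_kaehler_metric_on {x. fibre_norm x > b} (omega (- b\<^sup>2)) \<and>
           defines_imaginary_pseudo_kaehler_metric_on {x. fibre_norm x < b} (omega (- b\<^sup>2)))"
proof (intro conjI allI impI)
  fix T :: real
  assume "T > 0"
  then have "region 1 T = UNIV"
    by (auto simp: region_def add_nonneg_pos)
  then show "defines_kaehler_metric_on UNIV (omega T)"
    using defines_kaehler_region[of T] by simp
next
  show "defines_kaehler_metric_blowing_up_along_zero_section (omega 0)"
    unfolding defines_kaehler_metric_blowing_up_along_zero_section_def compl_zero_section
    using omega_extends_eguchi_hanson[of 0] kaehler_eguchi_hanson[of 0] blows_up_eguchi_hanson by blast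
next
  fix b :: real
  assume b: "b > 0"
  \<comment> \<open>\<open>fibre_norm\<close> enters \<open>region\<close> through its square\<close>
  have less_iff: "x < y \<longleftrightarrow> x\<^sup>2 < y\<^sup>2" if "x \<ge> 0" "y \<ge> 0" for x y :: real
    using that by (meson power2_less_imp_less power_strict_mono zero_less_numeral)
  have "{x. fibre_norm x > b} = region 1 (- b\<^sup>2)" "{x. fibre_norm x < b} = region (-1) (- b\<^sup>2)"
    using b by (simp_all add: region_def fibre_norm_nonneg less_iff[of b "fibre_norm _"] less_iff[of "fibre_norm _" b])
  then show "defines_kaehler_metric_on {x. fibre_norm x > b} (omega (- b\<^sup>2))"
    "defines_imaginary_pseudo_kaehler_metric_on {x. fibre_norm x < b} (omega (- b\<^sup>2))"
    using defines_kaehler_region defines_imaginary_region by simp_all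
qed

end
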